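(* Primitivity is necessary but not sufficient for two-fold irreducibility of nonnegative square matrices. That is: every two-fold irreducible nonnegative square matrix is primitive, and there exists a primitive nonnegative square matrix that is not two-fold irreducible.
   Context: A nonnegative $n\times n$ matrix $A$ is irreducible if for every pair of indices $(i,j)$ there is an integer $m\ge1$ with $[A^m]_{ij}>0$. A nonnegative square matrix $A$ is two-fold irreducible if $A$ and $A^{\top}A$ are both irreducible. A nonnegative square matrix $A$ is primitive if there is an integer $m\ge1$ such that all entries of $A^m$ are strictly positive. *)

theory Defs
  imports Complex_Main "Jordan_Normal_Form.Matrix"
begin

definition nonneg_square_mat :: "real mat \<Rightarrow> bool" where
  "nonneg_square_mat A \<longleftrightarrow>
     square_mat A \<and> (\<forall>i<dim_row A. \<forall>j<dim_col A. 0 \<le> A $$ (i, j))"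

text \<open>The next three notions are only meaningful for matrices satisfying
  \<^const>\<open>nonneg_square_mat\<close>, and are used only for those. The \<open>0 \<times> 0\<close> matrix is admitted;
  it vacuously has all three properties.\<close>

definition irreducible_mat :: "real mat \<Rightarrow> bool" where
  "irreducible_mat A \<longleftrightarrow>
     (\<forall>i<dim_row A. \<forall>j<dim_col A. \<exists>m\<ge>1. 0 < (A ^\<^sub>m m) $$ (i, j))"

definition two_fold_irreducible_mat :: "real mat \<Rightarrow> bool" where
  "two_fold_irreducible_mat A \<longleftrightarrow>
     irreducible_mat A \<and> irreducible_mat (transpose_mat A * A)"

definition primitive_mat :: "real mat \<Rightarrow> bool" where
  "primitive_mat A \<longleftrightarrow>
     (\<exists>m\<ge>1. \<forall>i<dim_row A. \<forall>j<dim_col A. 0 < (A ^\<^sub>m m) $$ (i, j))"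

end

theory Submission
  imports Defs
begin

text \<open>
  If \<open>A\<close> is irreducible, the differences of lengths of closed walks at a base vertex form a
  subgroup \<open>D\<close> of the integers, and any two walks from the base vertex to a common target have
  lengths that differ by an element of \<open>D\<close>. A positive entry of \<open>A\<^sup>T A\<close> means that its two indices
  have a common predecessor, so irreducibility of \<open>A\<^sup>T A\<close> extends this to walks with different
  targets. Prolonging a walk by one edge gives \<open>1 \<in> D\<close>, so there are closed walks of consecutive
  lengths, hence closed walks of every large length.
\<close>

section \<open>Entries of matrix powers and walks\<close>

lemma index_mult_mat_sum:
  fixes A B :: "'a :: semiring_0 mat"
  assumes "A \<in> carrier_mat n n" "B \<in> carrier_mat n n" "i < n" "j < n"
  shows "(A * B) $$ (i, j) = (\<Sum>k<n. A $$ (i, k) * B $$ (k, j))"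
  using assms by (auto simp: scalar_prod_def lessThan_atLeast0 intro!: sum.cong)

lemma index_transpose_mult_mat_sum:
  fixes A :: "'a :: semiring_0 mat"
  assumes "A \<in> carrier_mat n n" "i < n" "j < n"
  shows "(transpose_mat A * A) $$ (i, j) = (\<Sum>k<n. A $$ (k, i) * A $$ (k, j))"
  using assms by (auto simp: scalar_prod_def lessThan_atLeast0 intro!: sum.cong)

lemma index_pow_mat_nonneg:
  fixes A :: "'a :: linordered_semidom mat"
  assumes A: "A \<in> carrier_mat n n"
    and nonneg: "\<And>i j. i < n \<Longrightarrow> j < n \<Longrightarrow> 0 \<le> A $$ (i, j)"
    and "i < n" "j < n"
  shows "0 \<le> (A ^\<^sub>m m) $$ (i, j)"
  using \<open>j < n\<close>
proof (induction m arbitrary: j)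
  case 0
  then show ?case using A \<open>i < n\<close> by simp
next
  case (Suc m)
  have "(A ^\<^sub>m Suc m) $$ (i, j) = (\<Sum>k<n. (A ^\<^sub>m m) $$ (i, k) * A $$ (k, j))"
    using index_mult_mat_sum[OF pow_carrier_mat[OF A] A \<open>i < n\<close> Suc.prems] by simp
  then show ?case
    using Suc nonneg by (auto intro!: sum_nonneg mult_nonneg_nonneg)
qed

text \<open>Concatenation of walks: a positive entry of a power says that a walk of that length
  exists. The two walks contribute one positive summand, and nonnegativity rules out cancellation by
  the others.\<close>

lemma index_pow_mat_pos_add:
  fixes A :: "'a :: linordered_semidom mat"
  assumes A: "A \<in> carrier_mat n n"
    and nonneg: "\<And>i j. i < n \<Longrightarrow> j < n \<Longrightarrow> 0 \<le> A $$ (i, j)"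
    and ij: "i < n" "j < n" "k < n"
    and pos: "0 < (A ^\<^sub>m p) $$ (i, k)" "0 < (A ^\<^sub>m q) $$ (k, j)"
  shows "0 < (A ^\<^sub>m (p + q)) $$ (i, j)"
  using ij(2) pos(2)
proof (induction q arbitrary: j)
  case 0
  then show ?case using A ij pos(1) by (cases "k = j") auto
next
  case (Suc q)
  note nn = index_pow_mat_nonneg[OF A nonneg]
  have "(A ^\<^sub>m Suc q) $$ (k, j) = (\<Sum>l<n. (A ^\<^sub>m q) $$ (k, l) * A $$ (l, j))"
    using index_mult_mat_sum[OF pow_carrier_mat[OF A] A \<open>k < n\<close> Suc.prems(1)] by simp
  then have "(\<Sum>l<n. (A ^\<^sub>m q) $$ (k, l) * A $$ (l, j)) \<noteq> 0"
    using Suc.prems(2) by simp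
  then obtain l where l: "l < n" "(A ^\<^sub>m q) $$ (k, l) * A $$ (l, j) \<noteq> 0"
    by (auto elim: sum.not_neutral_contains_not_neutral)
  then have "0 < (A ^\<^sub>m q) $$ (k, l)" "0 < A $$ (l, j)"
    using nn[OF _ _ \<open>k < n\<close> \<open>l < n\<close>, of q] nonneg[OF \<open>l < n\<close> Suc.prems(1)]
    by (auto simp: less_le)
  then have "0 < (A ^\<^sub>m (p + q)) $$ (i, l) * A $$ (l, j)"
    using Suc.IH l(1) by simp
  also have "\<dots> \<le> (\<Sum>l<n. (A ^\<^sub>m (p + q)) $$ (i, l) * A $$ (l, j))"
    using l(1) Suc.prems(1) nonneg nn \<open>i < n\<close>
    by (intro member_le_sum) auto
  also have "\<dots> = (A ^\<^sub>m (p + Suc q)) $$ (i, j)"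
    using index_mult_mat_sum[OF pow_carrier_mat[OF A] A \<open>i < n\<close> Suc.prems(1)] by simp
  finally show ?case .
qed

text \<open>Induction along walks: a nonzero sum has a nonzero summand, so a nonzero entry of a
  power is witnessed by a walk through nonzero entries of \<open>B\<close>. Here \<open>refl\<close>
  serves the empty walk and \<open>step\<close> the last edge.\<close>

lemma pow_mat_related:
  fixes B :: "'a :: semiring_1 mat"
  assumes B: "B \<in> carrier_mat n n"
    and refl: "\<And>i. i < n \<Longrightarrow> P i i"
    and step: "\<And>i j k. i < n \<Longrightarrow> j < n \<Longrightarrow> k < n \<Longrightarrow> P i j \<Longrightarrow> B $$ (j, k) \<noteq> 0 \<Longrightarrow> P i k"
    and ij: "i < n" "j < n" "(B ^\<^sub>m m) $$ (i, j) \<noteq> 0"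
  shows "P i j"
  using ij(2,3)
proof (induction m arbitrary: j)
  case 0
  then show ?case using B refl \<open>i < n\<close> by (cases "i = j") auto
next
  case (Suc m)
  have "(\<Sum>l<n. (B ^\<^sub>m m) $$ (i, l) * B $$ (l, j)) \<noteq> 0"
    using index_mult_mat_sum[OF pow_carrier_mat[OF B] B \<open>i < n\<close> Suc.prems(1), of m] Suc.prems(2)
    by simp
  then obtain l where l: "l < n" "(B ^\<^sub>m m) $$ (i, l) * B $$ (l, j) \<noteq> 0"
    by (auto elim: sum.not_neutral_contains_not_neutral)
  then show ?case
    using Suc.IH Suc.prems(1) step[of i l j] \<open>i < n\<close> mult_not_zero[OF l(2)] by blast
qed

section \<open>Additive sets of natural numbers\<close>

lemma additive_set_mult:
  fixes S :: "nat set"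
  assumes "\<And>x y. x \<in> S \<Longrightarrow> y \<in> S \<Longrightarrow> x + y \<in> S" "x \<in> S" "0 < k"
  shows "k * x \<in> S"
  using \<open>0 < k\<close>
proof (induction k)
  case (Suc k)
  then show ?case using assms by (cases "k = 0") auto
qed simp

text \<open>Divide \<open>n\<close> by \<open>b\<close> and let each of the \<open>r\<close> units
  of the remainder turn one summand \<open>b\<close> into \<open>Suc b\<close>. The bound on
  \<open>n\<close> makes the quotient at least \<open>b\<close>, hence larger than \<open>r\<close>,
  so there are enough summands.\<close>

lemma additive_set_eventually_all:
  fixes S :: "nat set"
  assumes add: "\<And>x y. x \<in> S \<Longrightarrow> y \<in> S \<Longrightarrow> x + y \<in> S"
    and b: "b \<in> S" "Suc b \<in> S" and n: "b * b < n"
  shows "n \<in> S"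
proof (cases "b = 0")
  case True
  then show ?thesis using additive_set_mult[OF add, where x = 1 and k = n] b n by simp
next
  case False
  define q r where "q = n div b" and "r = n mod b"
  have "r < b" using False by (simp add: r_def)
  have "b \<le> q" using n False by (simp add: q_def less_eq_div_iff_mult_less_eq)
  have "n = (q - r) * b + r * Suc b"
  proof -
    have "(q - r) * b + r * Suc b = (q - r + r) * b + r" by (simp add: algebra_simps)
    also have "\<dots> = n" using \<open>r < b\<close> \<open>b \<le> q\<close> by (simp add: q_def r_def)
    finally show ?thesis by simp
  qed
  moreover have "(q - r) * b \<in> S"
    using additive_set_mult[OF add b(1)] \<open>r < b\<close> \<open>b \<le> q\<close> by simp
  moreover have "r * Suc b \<in> S" if "r \<noteq> 0"
    using additive_set_mult[OF add b(2)] that by blast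
  ultimately show ?thesis using add by (cases "r = 0") auto
qed

section \<open>Two-fold irreducibility implies primitivity\<close>

lemma two_fold_irreducible_imp_primitive:
  assumes "nonneg_square_mat A" and "two_fold_irreducible_mat A"
  shows "primitive_mat A"
proof (cases "dim_row A = 0")
  case True
  then show ?thesis by (auto simp: primitive_mat_def)
next
  case False
  define n where "n = dim_row A"
  define B where "B = transpose_mat A * A"
  have "0 < n" using False by (simp add: n_def)
  have A: "A \<in> carrier_mat n n"
    using assms(1) by (auto simp: nonneg_square_mat_def n_def)
  then have B: "B \<in> carrier_mat n n" by (simp add: B_def)
  have nonneg: "\<And>i j. i < n \<Longrightarrow> j < n \<Longrightarrow> 0 \<le> A $$ (i, j)"
    using assms(1) A by (auto simp: nonneg_square_mat_def)
  \<comment> \<open>The lengths of walks from \<open>u\<close> to \<open>v\<close>.\<close>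
  define W where "W u v = {m. 0 < (A ^\<^sub>m m) $$ (u, v)}" for u v
  have W_add: "p + q \<in> W u v" if "u < n" "w < n" "v < n" "p \<in> W u w" "q \<in> W w v" for p q u v w
    using index_pow_mat_pos_add[OF A nonneg, of u v w p q] that by (simp add: W_def)
  have W_edge: "Suc 0 \<in> W u v" if "u < n" "v < n" "A $$ (u, v) \<noteq> 0" for u v
    using that A nonneg[of u v] by (simp add: W_def)
  have W_ex: "\<exists>m\<ge>1. m \<in> W u v" if "u < n" "v < n" for u v
    using assms(2) that A
    by (auto simp: two_fold_irreducible_mat_def irreducible_mat_def W_def)
  have B_ex: "\<exists>m. (B ^\<^sub>m m) $$ (u, v) \<noteq> 0" if "u < n" "v < n" for u v
  proof -
    have "\<exists>m\<ge>1. 0 < (B ^\<^sub>m m) $$ (u, v)"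
      using assms(2) that B unfolding two_fold_irreducible_mat_def irreducible_mat_def B_def by blast
    then show ?thesis by (metis less_irrefl)
  qed
  define S where "S = W 0 0"
  have S_add: "x + y \<in> S" if "x \<in> S" "y \<in> S" for x y
    using W_add that \<open>0 < n\<close> by (auto simp: S_def)
  define D where "D = {int a - int b |a b. a \<in> S \<and> b \<in> S}"
  have D_add: "x + y \<in> D" if xy: "x \<in> D" "y \<in> D" for x y
  proof -
    obtain a b c d where "x = int a - int b" "y = int c - int d" "a \<in> S" "b \<in> S" "c \<in> S" "d \<in> S"
      using xy by (auto simp: D_def)
    then have "x + y = int (a + c) - int (b + d)" "a + c \<in> S" "b + d \<in> S"
      using S_add by auto
    then show ?thesis unfolding D_def by blast
  qed
  have same_target: "int x - int y \<in> D" if "v < n" "x \<in> W 0 v" "y \<in> W 0 v" for x y v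
  proof -
    \<comment> \<open>The same return walk closes both walks, so it cancels in the
      difference.\<close>
    obtain r where "r \<in> W v 0" using W_ex \<open>v < n\<close> \<open>0 < n\<close> by blast
    then have "x + r \<in> S" "y + r \<in> S" using W_add that \<open>0 < n\<close> by (auto simp: S_def)
    moreover have "int x - int y = int (x + r) - int (y + r)" by simp
    ultimately show ?thesis unfolding D_def by blast
  qed
  define P where "P u v \<longleftrightarrow> (\<forall>x\<in>W 0 u. \<forall>y\<in>W 0 v. int x - int y \<in> D)" for u v
  have P_step: "P i k" if "i < n" "j < n" "k < n" "P i j" "B $$ (j, k) \<noteq> 0" for i j k
  proof -
    have "(\<Sum>l<n. A $$ (l, j) * A $$ (l, k)) \<noteq> 0"
      using index_transpose_mult_mat_sum[OF A \<open>j < n\<close> \<open>k < n\<close>] that(5) by (simp add: B_def)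
    then obtain l where l: "l < n" "A $$ (l, j) * A $$ (l, k) \<noteq> 0"
      by (auto elim: sum.not_neutral_contains_not_neutral)
    \<comment> \<open>A walk to the common predecessor \<open>l\<close> extends by one edge to
      \<open>j\<close> and to \<open>k\<close>. The length \<open>a + Suc 0\<close> thus mediates:
      \<open>P i j\<close> compares it with \<open>x\<close>, and \<open>same_target\<close> at
      \<open>k\<close> compares it with \<open>y\<close>.\<close>
    obtain a where "a \<in> W 0 l" using W_ex l(1) \<open>0 < n\<close> by blast
    then have a: "a + Suc 0 \<in> W 0 j" "a + Suc 0 \<in> W 0 k"
      using W_add[OF \<open>0 < n\<close> l(1) _ _ W_edge[OF l(1)]] mult_not_zero[OF l(2)] that(2,3)
      by blast+
    show ?thesis
      unfolding P_def
    proof (intro ballI)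
      fix x y assume "x \<in> W 0 i" "y \<in> W 0 k"
      then have "int x - int (a + Suc 0) \<in> D" "int (a + Suc 0) - int y \<in> D"
        using a that(3,4) same_target unfolding P_def by blast+
      from D_add[OF this] show "int x - int y \<in> D" by simp
    qed
  qed
  have P_all: "P u v" if "u < n" "v < n" for u v
  proof -
    obtain m where m: "(B ^\<^sub>m m) $$ (u, v) \<noteq> 0" using B_ex[OF \<open>u < n\<close> \<open>v < n\<close>] by blast
    show ?thesis
      by (rule pow_mat_related[where P = P, OF B _ P_step that m])
        (auto simp: P_def same_target)
  qed
  obtain s where s: "s \<in> S" "1 \<le> s" using W_ex \<open>0 < n\<close> by (auto simp: S_def)
  have "1 \<in> D"
  proof -
    \<comment> \<open>Dropping the last edge of a closed walk of length \<open>s\<close> leaves a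
      walk to some \<open>l\<close> of length \<open>s - 1\<close>; \<open>P 0 l\<close> puts the
      difference 1 into \<open>D\<close>.\<close>
    obtain p where p: "s = Suc p" using s(2) by (cases s) auto
    have "(\<Sum>l<n. (A ^\<^sub>m p) $$ (0, l) * A $$ (l, 0)) \<noteq> 0"
      using index_mult_mat_sum[OF pow_carrier_mat[OF A] A \<open>0 < n\<close> \<open>0 < n\<close>, of p] s(1)
      by (simp add: S_def W_def p)
    then obtain l where l: "l < n" "(A ^\<^sub>m p) $$ (0, l) * A $$ (l, 0) \<noteq> 0"
      by (auto elim: sum.not_neutral_contains_not_neutral)
    then have "p \<in> W 0 l"
      using index_pow_mat_nonneg[OF A nonneg \<open>0 < n\<close> l(1), of p] by (auto simp: W_def less_le)
    then have "int s - int p \<in> D"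
      using P_all[OF \<open>0 < n\<close> l(1)] s(1) by (auto simp: P_def S_def)
    then show ?thesis by (simp add: p)
  qed
  then obtain a b where ab: "a \<in> S" "b \<in> S" "1 = int a - int b" by (auto simp: D_def)
  then have "a = Suc b" by linarith
  define N where "N = Suc (b * b)"
  have S_large: "m \<in> S" if "N \<le> m" for m
    using additive_set_eventually_all[OF S_add ab(2)] ab(1) \<open>a = Suc b\<close> that by (simp add: N_def)
  obtain f where f: "\<And>u v. u < n \<Longrightarrow> v < n \<Longrightarrow> f u v \<in> W u v"
    using W_ex by metis
  \<comment> \<open>A single exponent for all pairs: go from \<open>u\<close> to 0, circle at 0,
    then go on to \<open>v\<close>. Both sums dominate their summands, so the time left for circling
    is at least \<open>N\<close> whatever \<open>u\<close> and \<open>v\<close> are.\<close>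
  define M where "M = N + (\<Sum>u<n. f u 0) + (\<Sum>v<n. f 0 v)"
  have "M \<in> W u v" if "u < n" "v < n" for u v
  proof -
    have "f u 0 \<le> (\<Sum>u<n. f u 0)" "f 0 v \<le> (\<Sum>v<n. f 0 v)"
      using that by (auto intro: member_le_sum[where f = "\<lambda>u. f u 0"] member_le_sum[where f = "f 0"])
    then have le: "N \<le> M - f u 0 - f 0 v" "M = f u 0 + (M - f u 0 - f 0 v) + f 0 v"
      by (auto simp: M_def)
    have "f u 0 + (M - f u 0 - f 0 v) \<in> W u 0"
      using W_add[OF \<open>u < n\<close> \<open>0 < n\<close> \<open>0 < n\<close>] f[OF \<open>u < n\<close> \<open>0 < n\<close>] S_large[OF le(1)]
      by (simp add: S_def)
    then show ?thesis
      using W_add[OF \<open>u < n\<close> \<open>0 < n\<close> \<open>v < n\<close>] f[OF \<open>0 < n\<close> \<open>v < n\<close>] le(2) by metis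
  qed
  moreover have "1 \<le> M" by (simp add: M_def N_def)
  ultimately show ?thesis
    using A unfolding primitive_mat_def W_def by auto
qed

section \<open>A primitive matrix that is not two-fold irreducible\<close>

text \<open>The digraph has the cycles \<open>0 \<rightarrow> 0\<close> and \<open>0 \<rightarrow> 1 \<rightarrow> 2 \<rightarrow> 0\<close> of coprime lengths, but
  the only predecessor of vertex 2 is vertex 1, which has no other successor.\<close>

definition loop_triangle_mat :: "real mat" where
  "loop_triangle_mat = mat 3 3 (\<lambda>(i, j). if (i, j) \<in> {(0, 0), (0, 1), (1, 2), (2, 0)} then 1 else 0)"

lemma loop_triangle_mat_carrier: "loop_triangle_mat \<in> carrier_mat 3 3"
  by (simp add: loop_triangle_mat_def)

lemma nonneg_loop_triangle_mat: "nonneg_square_mat loop_triangle_mat"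
  by (auto simp: nonneg_square_mat_def loop_triangle_mat_def)

lemma less_3_cases: "(i::nat) < 3 \<Longrightarrow> i = 0 \<or> i = 1 \<or> i = 2"
  by linarith

lemma primitive_loop_triangle_mat: "primitive_mat loop_triangle_mat"
proof -
  let ?A = loop_triangle_mat
  note A = loop_triangle_mat_carrier
  have nonneg: "\<And>i j. i < 3 \<Longrightarrow> j < 3 \<Longrightarrow> 0 \<le> ?A $$ (i, j)"
    by (simp add: loop_triangle_mat_def)
  note add = index_pow_mat_pos_add[OF A nonneg, simplified]
  have edge: "0 < (?A ^\<^sub>m 1) $$ (0, 0)" "0 < (?A ^\<^sub>m 1) $$ (0, 1)"
    "0 < (?A ^\<^sub>m 1) $$ (1, 2)" "0 < (?A ^\<^sub>m 1) $$ (2, 0)"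
    by (simp_all add: loop_triangle_mat_def)
  have two: "0 < (?A ^\<^sub>m 2) $$ (0, 0)" "0 < (?A ^\<^sub>m 2) $$ (0, 1)" "0 < (?A ^\<^sub>m 2) $$ (0, 2)"
    "0 < (?A ^\<^sub>m 2) $$ (1, 0)" "0 < (?A ^\<^sub>m 2) $$ (2, 0)" "0 < (?A ^\<^sub>m 2) $$ (2, 1)"
    using add[OF _ _ _ edge(1) edge(1)] add[OF _ _ _ edge(1) edge(2)] add[OF _ _ _ edge(2) edge(3)]
      add[OF _ _ _ edge(3) edge(4)] add[OF _ _ _ edge(4) edge(1)] add[OF _ _ _ edge(4) edge(2)]
    by (simp_all add: numeral_2_eq_2)
  \<comment> \<open>The exponent is 2 + 2: every vertex reaches 0 in two steps, and 0 reaches every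
    vertex in two steps.\<close>
  have "0 < (?A ^\<^sub>m 4) $$ (i, j)" if "i < 3" "j < 3" for i j
  proof -
    have "0 < (?A ^\<^sub>m 2) $$ (i, 0)" "0 < (?A ^\<^sub>m 2) $$ (0, j)"
      using less_3_cases[OF that(1)] less_3_cases[OF that(2)] two by auto
    from add[OF that _ this] show ?thesis by simp
  qed
  then show ?thesis
    using A unfolding primitive_mat_def by (intro exI[of _ 4]) auto
qed

lemma not_two_fold_irreducible_loop_triangle_mat:
  "\<not> two_fold_irreducible_mat loop_triangle_mat"
proof
  let ?A = loop_triangle_mat
  let ?B = "transpose_mat ?A * ?A"
  have B: "?B \<in> carrier_mat 3 3"
    using loop_triangle_mat_carrier by simp
  assume "two_fold_irreducible_mat ?A"
  then have "irreducible_mat ?B" by (simp add: two_fold_irreducible_mat_def)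
  then have "\<exists>m\<ge>1. 0 < (?B ^\<^sub>m m) $$ (2, 0)"
    unfolding irreducible_mat_def carrier_matD[OF B] by simp
  then obtain m where "0 < (?B ^\<^sub>m m) $$ (2, 0)" by blast
  then have m: "(?B ^\<^sub>m m) $$ (2, 0) \<noteq> 0" by (rule less_imp_neq[symmetric])
  have isolated: "?B $$ (2, k) = 0" if "k < 3" "k \<noteq> 2" for k
    using index_transpose_mult_mat_sum[OF loop_triangle_mat_carrier _ that(1), of 2] that
    by (auto simp: loop_triangle_mat_def intro!: sum.neutral)
  \<comment> \<open>In the digraph of \<open>?B\<close> no edge leaves 2 for another vertex. Stated
    as an implication, this invariant is reflexive at every vertex, and the assumed walk from 2 to 0
    contradicts it.\<close>
  have "(2::nat) = 2 \<longrightarrow> (0::nat) = 2"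
  proof (rule pow_mat_related[where P = "\<lambda>i j. i = 2 \<longrightarrow> j = 2", OF B _ _ _ _ m])
    fix i j k :: nat
    assume "k < 3" "i = 2 \<longrightarrow> j = 2" "?B $$ (j, k) \<noteq> 0"
    then show "i = 2 \<longrightarrow> k = 2" using isolated by blast
  qed simp_all
  then show False by simp
qed

theorem proposition20:
  shows "(\<forall>A. nonneg_square_mat A \<and> two_fold_irreducible_mat A \<longrightarrow> primitive_mat A) \<and>
         (\<exists>A. nonneg_square_mat A \<and> primitive_mat A \<and> \<not> two_fold_irreducible_mat A)"
  using two_fold_irreducible_imp_primitive nonneg_loop_triangle_mat primitive_loop_triangle_mat
    not_two_fold_irreducible_loop_triangle_mat by blast

end
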